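(* Let $\mathcal{M}$ be an infinite-dimensional atomic von Neumann algebra with a faithful normal tracial state $\tau$. Let $\{e_n\}_{n\ge 1}$ be an infinite sequence of mutually orthogonal minimal projections in $\mathcal{M}$ with $\sum_{n=1}^\infty e_n=\mathbf{1}$, enumerated so that the numbers $t_n:=\tau(e_n)$, $n\ge 1$, satisfy $t_1\ge t_2\ge\ldots\ge t_n\ge\ldots$. Then the following assertions are equivalent: (1) the set $\tau(P(\mathcal{M}))=\{\tau(p): p\in P(\mathcal{M})\}\subseteq[0,1]$ is convex; (2) $t_n\le 1-\sum_{k=1}^n t_k$ for all $n\ge 1$.
   Context: $P(\mathcal{M})$ denotes the set of all (self-adjoint) projections of $\mathcal{M}$, and $\mathbf{1}$ is the unit of $\mathcal{M}$. A von Neumann algebra is atomic if every nonzero projection in it dominates a minimal projection. A tracial state $\tau$ is a state with $\tau(xy)=\tau(yx)$ for all $x,y\in\mathcal{M}$. *)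

theory Defs
  imports "HOL-Analysis.Analysis"
begin

text \<open>
  Complex Hilbert spaces. The complex inner product \<open>cinner\<close> is linear in its first argument.
  Its real part is the inner product of the class \<open>real_inner\<close>, so that the norm and the topology
  are the usual ones: \<open>norm x = sqrt (Re (cinner x x))\<close>.
\<close>

class scaleC =
  fixes scaleC :: "complex \<Rightarrow> 'a \<Rightarrow> 'a"  (infixr \<open>*\<^sub>C\<close> 75)

class complex_vector = real_vector + scaleC +
  assumes scaleC_add_right: "a *\<^sub>C (x + y) = a *\<^sub>C x + a *\<^sub>C y"
    and scaleC_add_left: "(a + b) *\<^sub>C x = a *\<^sub>C x + b *\<^sub>C x"
    and scaleC_scaleC: "a *\<^sub>C b *\<^sub>C x = (a * b) *\<^sub>C x"
    and scaleC_one: "1 *\<^sub>C x = x"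
    and scaleC_of_real: "complex_of_real r *\<^sub>C x = r *\<^sub>R x"

global_interpretation complex_vector: vector_space "scaleC :: complex \<Rightarrow> 'a \<Rightarrow> 'a::complex_vector"
  defines cspan = complex_vector.span
  by unfold_locales (simp_all add: scaleC_add_right scaleC_add_left scaleC_scaleC scaleC_one)

class complex_inner = real_inner + complex_vector +
  fixes cinner :: "'a \<Rightarrow> 'a \<Rightarrow> complex"
  assumes cinner_commute: "cinner x y = cnj (cinner y x)"
    and cinner_add_left: "cinner (x + y) z = cinner x z + cinner y z"
    and cinner_scaleC_left: "cinner (c *\<^sub>C x) y = c * cinner x y"
    and Re_cinner: "Re (cinner x y) = inner x y"

class complex_hilbert = complex_inner + complete_space

lemma cinner_self: "cinner x x = complex_of_real ((norm x)\<^sup>2)"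
proof -
  have "Im (cinner x x) = 0"
    using cinner_commute[of x x] by (metis cnj.simps(2) neg_equal_zero)
  then show ?thesis
    by (simp add: complex_eq_iff Re_cinner power2_norm_eq_inner)
qed

lemma norm_scaleC:
  fixes x :: "'a::complex_inner"
  shows "norm (c *\<^sub>C x) = cmod c * norm x"
proof -
  have "cinner (c *\<^sub>C x) (c *\<^sub>C x) = (c * cnj c) * cinner x x"
    by (metis cinner_commute cinner_scaleC_left complex_cnj_mult mult.assoc mult.left_commute)
  then have "complex_of_real ((norm (c *\<^sub>C x))\<^sup>2) = complex_of_real ((cmod c * norm x)\<^sup>2)"
    by (simp only: cinner_self complex_norm_square[symmetric] power_mult_distrib of_real_mult of_real_power)
  then have "(norm (c *\<^sub>C x))\<^sup>2 = (cmod c * norm x)\<^sup>2"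
    by (simp only: of_real_eq_iff)
  then show ?thesis
    by (simp add: power2_eq_iff_nonneg)
qed

lemma bounded_linear_scaleC: "bounded_linear (\<lambda>x::'a::complex_inner. c *\<^sub>C x)"
proof (rule bounded_linear_intro[where K = "cmod c"])
  show "c *\<^sub>C (r *\<^sub>R x) = r *\<^sub>R (c *\<^sub>C x)" for r and x :: 'a
    by (metis scaleC_of_real scaleC_scaleC mult.commute)
qed (simp_all add: scaleC_add_right norm_scaleC mult.commute)

instantiation blinfun :: (real_normed_vector, complex_inner) complex_vector
begin

lift_definition scaleC_blinfun :: "complex \<Rightarrow> 'a \<Rightarrow>\<^sub>L 'b \<Rightarrow> 'a \<Rightarrow>\<^sub>L 'b"
  is "\<lambda>c f x. c *\<^sub>C f x"
  by (rule bounded_linear_compose[OF bounded_linear_scaleC])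

instance
  by standard
    (transfer, simp add: fun_eq_iff scaleC_add_right scaleC_add_left scaleC_scaleC scaleC_one scaleC_of_real)+

end

text \<open>
  The type \<open>'h \<Rightarrow>\<^sub>L 'h\<close> consists of the bounded real-linear operators; \<open>B(H)\<close> is the set of the
  complex-linear ones among them.
\<close>

definition cops :: "('h::complex_hilbert \<Rightarrow>\<^sub>L 'h) set"
  where "cops = {T. \<forall>c x. blinfun_apply T (c *\<^sub>C x) = c *\<^sub>C blinfun_apply T x}"

text \<open>The adjoint exists by the Riesz representation theorem and is unique.\<close>

definition cadj :: "('h::complex_hilbert \<Rightarrow>\<^sub>L 'h) \<Rightarrow> 'h \<Rightarrow>\<^sub>L 'h"
  where "cadj T = (THE S. \<forall>x y. cinner (blinfun_apply T x) y = cinner x (blinfun_apply S y))"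

definition positive_op :: "('h::complex_hilbert \<Rightarrow>\<^sub>L 'h) \<Rightarrow> bool"
  where "positive_op T \<longleftrightarrow> T \<in> cops \<and> (\<forall>x. cinner (blinfun_apply T x) x \<in> \<real>\<^sub>\<ge>\<^sub>0)"

definition op_le :: "('h::complex_hilbert \<Rightarrow>\<^sub>L 'h) \<Rightarrow> ('h \<Rightarrow>\<^sub>L 'h) \<Rightarrow> bool"
  where "op_le S T \<longleftrightarrow> positive_op (T - S)"

definition commutant :: "('h::complex_hilbert \<Rightarrow>\<^sub>L 'h) set \<Rightarrow> ('h \<Rightarrow>\<^sub>L 'h) set"
  where "commutant M = {S \<in> cops. \<forall>T\<in>M. S o\<^sub>L T = T o\<^sub>L S}"

text \<open>
  A von Neumann algebra on \<open>H\<close> is a *-subalgebra of \<open>B(H)\<close> that equals its bicommutant; the algebra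
  operations and the unit need no separate clause, because every commutant is a unital subalgebra.
\<close>

definition von_neumann_algebra :: "('h::complex_hilbert \<Rightarrow>\<^sub>L 'h) set \<Rightarrow> bool"
  where "von_neumann_algebra M \<longleftrightarrow>
    M \<subseteq> cops \<and> (\<forall>T\<in>M. cadj T \<in> M) \<and> commutant (commutant M) = M"

definition infinite_dimensional :: "'a::complex_vector set \<Rightarrow> bool"
  where "infinite_dimensional V \<longleftrightarrow> \<not> (\<exists>B. finite B \<and> V \<subseteq> cspan B)"

definition self_adjoint :: "('h::complex_hilbert \<Rightarrow>\<^sub>L 'h) \<Rightarrow> bool"
  where "self_adjoint T \<longleftrightarrow>
    (\<forall>x y. cinner (blinfun_apply T x) y = cinner x (blinfun_apply T y))"

definition projections :: "('h::complex_hilbert \<Rightarrow>\<^sub>L 'h) set \<Rightarrow> ('h \<Rightarrow>\<^sub>L 'h) set"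
  where "projections M = {p \<in> M. p o\<^sub>L p = p \<and> self_adjoint p}"

definition minimal_projection :: "('h::complex_hilbert \<Rightarrow>\<^sub>L 'h) set \<Rightarrow> ('h \<Rightarrow>\<^sub>L 'h) \<Rightarrow> bool"
  where "minimal_projection M p \<longleftrightarrow>
    p \<in> projections M \<and> p \<noteq> 0 \<and> (\<forall>q\<in>projections M. op_le q p \<longrightarrow> q = 0 \<or> q = p)"

definition atomic :: "('h::complex_hilbert \<Rightarrow>\<^sub>L 'h) set \<Rightarrow> bool"
  where "atomic M \<longleftrightarrow>
    (\<forall>p\<in>projections M. p \<noteq> 0 \<longrightarrow> (\<exists>q. minimal_projection M q \<and> op_le q p))"

text \<open>
  Functionals on \<open>M\<close> are functions on all operators of which only the values on \<open>M\<close> matter.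
\<close>

definition state :: "('h::complex_hilbert \<Rightarrow>\<^sub>L 'h) set \<Rightarrow> (('h \<Rightarrow>\<^sub>L 'h) \<Rightarrow> complex) \<Rightarrow> bool"
  where "state M \<tau> \<longleftrightarrow>
    (\<forall>S\<in>M. \<forall>T\<in>M. \<tau> (S + T) = \<tau> S + \<tau> T) \<and>
    (\<forall>c. \<forall>T\<in>M. \<tau> (c *\<^sub>C T) = c * \<tau> T) \<and>
    (\<forall>T\<in>M. positive_op T \<longrightarrow> \<tau> T \<in> \<real>\<^sub>\<ge>\<^sub>0) \<and>
    \<tau> id_blinfun = 1"

definition tracial_state :: "('h::complex_hilbert \<Rightarrow>\<^sub>L 'h) set \<Rightarrow> (('h \<Rightarrow>\<^sub>L 'h) \<Rightarrow> complex) \<Rightarrow> bool"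
  where "tracial_state M \<tau> \<longleftrightarrow> state M \<tau> \<and> (\<forall>S\<in>M. \<forall>T\<in>M. \<tau> (S o\<^sub>L T) = \<tau> (T o\<^sub>L S))"

definition faithful_functional :: "('h::complex_hilbert \<Rightarrow>\<^sub>L 'h) set \<Rightarrow> (('h \<Rightarrow>\<^sub>L 'h) \<Rightarrow> complex) \<Rightarrow> bool"
  where "faithful_functional M \<tau> \<longleftrightarrow> (\<forall>T\<in>M. \<tau> (cadj T o\<^sub>L T) = 0 \<longrightarrow> T = 0)"

text \<open>
  Normality: \<open>\<tau> (sup F) = sup (\<tau> ` F)\<close> for every upward directed family \<open>F\<close> of positive elements
  of \<open>M\<close> that has a least upper bound in \<open>M\<close> (by Vigier's theorem, every norm-bounded \<open>F\<close>).
  Elements above a member of \<open>F\<close> are automatically self-adjoint.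
\<close>

definition upward_directed :: "('h::complex_hilbert \<Rightarrow>\<^sub>L 'h) set \<Rightarrow> bool"
  where "upward_directed F \<longleftrightarrow>
    F \<noteq> {} \<and> (\<forall>A\<in>F. \<forall>B\<in>F. \<exists>C\<in>F. op_le A C \<and> op_le B C)"

definition is_lub_in :: "('h::complex_hilbert \<Rightarrow>\<^sub>L 'h) set \<Rightarrow> ('h \<Rightarrow>\<^sub>L 'h) set \<Rightarrow> ('h \<Rightarrow>\<^sub>L 'h) \<Rightarrow> bool"
  where "is_lub_in M F T \<longleftrightarrow>
    T \<in> M \<and> (\<forall>A\<in>F. op_le A T) \<and> (\<forall>S\<in>M. (\<forall>A\<in>F. op_le A S) \<longrightarrow> op_le T S)"

definition normal_functional :: "('h::complex_hilbert \<Rightarrow>\<^sub>L 'h) set \<Rightarrow> (('h \<Rightarrow>\<^sub>L 'h) \<Rightarrow> complex) \<Rightarrow> bool"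
  where "normal_functional M \<tau> \<longleftrightarrow>
    (\<forall>F T. F \<subseteq> {A \<in> M. positive_op A} \<and> upward_directed F \<and> is_lub_in M F T \<longrightarrow>
      Re (\<tau> T) = (SUP A\<in>F. Re (\<tau> A)))"

text \<open>
  A state maps projections into \<open>[0,1]\<close>; thus \<open>Re (\<tau> p)\<close> is the value \<open>\<tau> p\<close> itself, read as a
  real number, and convexity of \<open>\<tau> ` projections M\<close> in \<open>\<complex>\<close> is convexity of a subset of \<open>[0,1]\<close>.
\<close>

lemma state_projections:
  assumes M: "von_neumann_algebra M" and \<tau>: "state M \<tau>"
  shows "\<tau> ` projections M \<subseteq> complex_of_real ` {0..1}"
proof (rule image_subsetI)
  fix p assume p: "p \<in> projections M"
  have bicomm: "commutant (commutant M) = M"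
    using M by (simp add: von_neumann_algebra_def)
  have pM: "p \<in> M" and idem: "p o\<^sub>L p = p" and sa: "self_adjoint p"
    using p by (auto simp: projections_def)
  have pc: "p \<in> cops"
    using M pM by (auto simp: von_neumann_algebra_def)
  define q where "q = id_blinfun - p"
  have q_app: "blinfun_apply q x = x - blinfun_apply p x" for x
    by (simp add: q_def blinfun.diff_left)
  have p_app: "blinfun_apply p (blinfun_apply p x) = blinfun_apply p x" for x
    using idem by (metis blinfun_apply_blinfun_compose)
  have qc: "q \<in> cops"
    using pc by (simp add: cops_def q_app complex_vector.scale_right_diff_distrib)
  have qM: "q \<in> M"
  proof -
    have "q o\<^sub>L S = S o\<^sub>L q" if S: "S \<in> commutant M" for S
    proof (rule blinfun_eqI)
      fix x
      have "S o\<^sub>L p = p o\<^sub>L S"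
        using S pM by (simp add: commutant_def)
      then have "blinfun_apply S (blinfun_apply p x) = blinfun_apply p (blinfun_apply S x)"
        by (metis blinfun_apply_blinfun_compose)
      then show "blinfun_apply (q o\<^sub>L S) x = blinfun_apply (S o\<^sub>L q) x"
        by (simp add: q_app blinfun.diff_right)
    qed
    then have "q \<in> commutant (commutant M)"
      using qc by (simp add: commutant_def)
    then show ?thesis
      using bicomm by simp
  qed
  have sq: "complex_of_real ((norm x)\<^sup>2) \<in> \<real>\<^sub>\<ge>\<^sub>0" for x :: 'a
    by (simp only: nonneg_Reals_of_real_iff zero_le_power2)
  have p_sq: "cinner (blinfun_apply p x) x = complex_of_real ((norm (blinfun_apply p x))\<^sup>2)" for x
    using sa p_app[of x] cinner_self[of "blinfun_apply p x"] unfolding self_adjoint_def by metis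
  have "cinner (blinfun_apply q x) x = complex_of_real ((norm (blinfun_apply q x))\<^sup>2)" for x
  proof -
    have diff: "cinner (a - b) c = cinner a c - cinner b c" for a b c :: 'a
      using cinner_add_left[of "a - b" b c] by simp
    have "cinner (blinfun_apply p x) (blinfun_apply q x) = 0"
    proof -
      have "blinfun_apply p (blinfun_apply q x) = 0"
        by (simp add: q_app blinfun.diff_right p_app)
      then have "cinner (blinfun_apply p x) (blinfun_apply q x) = cinner x 0"
        using sa by (simp add: self_adjoint_def)
      also have "\<dots> = 0"
        using cinner_commute[of x 0] cinner_add_left[of 0 0 x] by simp
      finally show ?thesis .
    qed
    then have "cinner x (blinfun_apply q x) = cinner (blinfun_apply q x) (blinfun_apply q x)"
      using diff[of x "blinfun_apply p x" "blinfun_apply q x"] by (simp add: q_app)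
    then have "cinner x (blinfun_apply q x) = complex_of_real ((norm (blinfun_apply q x))\<^sup>2)"
      by (simp only: cinner_self)
    then show ?thesis
      by (metis cinner_commute complex_cnj_complex_of_real)
  qed
  then have "positive_op q"
    using qc sq by (simp add: positive_op_def)
  moreover have "positive_op p"
    using pc sq p_sq by (simp add: positive_op_def)
  ultimately have nn: "\<tau> p \<in> \<real>\<^sub>\<ge>\<^sub>0" "\<tau> q \<in> \<real>\<^sub>\<ge>\<^sub>0"
    using \<tau> pM qM by (auto simp: state_def)
  have "\<tau> (p + q) = \<tau> p + \<tau> q"
    using \<tau> pM qM by (simp add: state_def)
  moreover have "p + q = id_blinfun"
    by (simp add: q_def)
  ultimately have one: "\<tau> p + \<tau> q = 1"
    using \<tau> by (simp add: state_def)
  obtain r s where "\<tau> p = complex_of_real r" "r \<ge> 0" "\<tau> q = complex_of_real s" "s \<ge> 0"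
    using nn by (auto elim!: nonneg_Reals_cases)
  moreover from this one have "r + s = 1"
    by (metis of_real_add of_real_eq_1_iff)
  ultimately show "\<tau> p \<in> complex_of_real ` {0..1}"
    by auto
qed

end

theory Submission
  imports Defs
begin

text \<open>
  By normality, \<open>\<Sum>n t\<^sub>n = 1\<close> and every subsum of \<open>(t\<^sub>n)\<close> is the trace of a projection. Under (2) the greedy
  algorithm (Kakeya) represents every number in \<open>[0,1]\<close> as a subsum, which gives (1). Conversely, suppose
  \<open>t\<^sub>n > 1 - \<Sum>k\<le>n t\<^sub>k\<close>; then no projection \<open>p\<close> has its trace strictly between these two numbers. If
  \<open>p e\<^sub>k = 0\<close> for all \<open>k \<le> n\<close>, then \<open>p \<le> 1 - \<Sum>k\<le>n e\<^sub>k\<close>; and if \<open>p e\<^sub>k \<noteq> 0\<close> for some \<open>k \<le> n\<close>, then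
  \<open>\<tau>(p) \<ge> \<tau>(e\<^sub>k) \<ge> t\<^sub>n\<close> because \<open>e\<^sub>k\<close> is minimal.
\<close>

section \<open>Self-adjointness and positivity in terms of the real inner product\<close>

text \<open>The imaginary part is read off from the real part at \<open>\<i> *\<^sub>C x\<close>.
  Identities for \<open>cinner\<close> thereby reduce to \<open>inner\<close>, where the limit and
  algebra rules apply.\<close>

lemma cinner_eq_Complex: "cinner x y = Complex (inner x y) (- inner (\<i> *\<^sub>C x) y)"
  using Re_cinner[of "\<i> *\<^sub>C x" y] by (simp add: complex_eq_iff Re_cinner cinner_scaleC_left)

text \<open>Complex linearity moves \<open>\<i>\<close> through \<open>T\<close>, so symmetry for
  the real inner product also yields equality of the imaginary parts.\<close>

lemma self_adjointI:
  assumes "T \<in> cops" "\<And>x y. inner (blinfun_apply T x) y = inner x (blinfun_apply T y)"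
  shows "self_adjoint T"
proof -
  have "\<i> *\<^sub>C blinfun_apply T x = blinfun_apply T (\<i> *\<^sub>C x)" for x
    using assms(1) by (simp add: cops_def)
  then show ?thesis
    by (simp add: self_adjoint_def cinner_eq_Complex assms(2))
qed

lemma self_adjoint_inner:
  "self_adjoint T \<Longrightarrow> inner (blinfun_apply T x) y = inner x (blinfun_apply T y)"
  unfolding self_adjoint_def by (metis Re_cinner)

lemma positive_op_iff:
  "positive_op T \<longleftrightarrow> T \<in> cops \<and>
    (\<forall>x. 0 \<le> inner (blinfun_apply T x) x \<and> inner (\<i> *\<^sub>C blinfun_apply T x) x = 0)"
  by (auto simp: positive_op_def cinner_eq_Complex complex_nonneg_Reals_iff)

lemma self_adjoint_positive_opI:
  assumes "T \<in> cops" "self_adjoint T" "\<And>x. 0 \<le> inner (blinfun_apply T x) x"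
  shows "positive_op T"
proof -
  have "inner (\<i> *\<^sub>C blinfun_apply T x) x = 0" for x
  proof -
    have "cinner (blinfun_apply T x) x = cnj (cinner (blinfun_apply T x) x)"
      using assms(2) cinner_commute unfolding self_adjoint_def by metis
    then show ?thesis
      by (simp add: cinner_eq_Complex complex_eq_iff)
  qed
  then show ?thesis
    using assms by (simp add: positive_op_iff)
qed

section \<open>Commutants: algebraic operations and strong limits\<close>

lemma cops_limit:
  assumes "\<And>n. A n \<in> cops"
    and "\<And>x. (\<lambda>n. blinfun_apply (A n) x) \<longlonglongrightarrow> blinfun_apply T x"
  shows "T \<in> cops"
proof -
  have "blinfun_apply T (c *\<^sub>C x) = c *\<^sub>C blinfun_apply T x" for c x
  proof (rule LIMSEQ_unique[OF assms(2)])
    have "(\<lambda>n. c *\<^sub>C blinfun_apply (A n) x) \<longlonglongrightarrow> c *\<^sub>C blinfun_apply T x"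
      by (intro bounded_linear.tendsto[OF bounded_linear_scaleC] assms(2))
    then show "(\<lambda>n. blinfun_apply (A n) (c *\<^sub>C x)) \<longlonglongrightarrow> c *\<^sub>C blinfun_apply T x"
      using assms(1) by (simp add: cops_def)
  qed
  then show ?thesis
    by (simp add: cops_def)
qed

text \<open>Each \<open>S\<close> in \<open>N\<close> is continuous, so the relation
  \<open>A n S = S A n\<close>, evaluated at a vector, survives pointwise limits.\<close>

lemma commutant_limit:
  assumes A: "\<And>n. A n \<in> commutant N"
    and lim: "\<And>x. (\<lambda>n. blinfun_apply (A n) x) \<longlonglongrightarrow> blinfun_apply T x"
  shows "T \<in> commutant N"
proof -
  have "T o\<^sub>L S = S o\<^sub>L T" if S: "S \<in> N" for S
  proof (rule blinfun_eqI)
    fix x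
    have "A n o\<^sub>L S = S o\<^sub>L A n" for n
      using A S by (simp add: commutant_def)
    then have "blinfun_apply (A n) (blinfun_apply S x) = blinfun_apply S (blinfun_apply (A n) x)" for n
      by (metis blinfun_apply_blinfun_compose)
    moreover have "(\<lambda>n. blinfun_apply S (blinfun_apply (A n) x)) \<longlonglongrightarrow> blinfun_apply S (blinfun_apply T x)"
      by (intro tendsto_intros lim)
    ultimately have "blinfun_apply T (blinfun_apply S x) = blinfun_apply S (blinfun_apply T x)"
      using LIMSEQ_unique lim[of "blinfun_apply S x"] by simp
    then show "blinfun_apply (T o\<^sub>L S) x = blinfun_apply (S o\<^sub>L T) x"
      by simp
  qed
  moreover have "T \<in> cops"
    by (rule cops_limit[OF _ lim]) (use A in \<open>simp add: commutant_def\<close>)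
  ultimately show ?thesis
    by (simp add: commutant_def)
qed

lemma commutant_iff:
  "S \<in> commutant N \<longleftrightarrow> (\<forall>c x. blinfun_apply S (c *\<^sub>C x) = c *\<^sub>C blinfun_apply S x) \<and>
    (\<forall>T\<in>N. \<forall>x. blinfun_apply S (blinfun_apply T x) = blinfun_apply T (blinfun_apply S x))"
proof -
  have "S o\<^sub>L T = T o\<^sub>L S \<longleftrightarrow>
      (\<forall>x. blinfun_apply S (blinfun_apply T x) = blinfun_apply T (blinfun_apply S x))" for T
    by (auto intro!: blinfun_eqI dest: arg_cong[of _ _ blinfun_apply] simp: fun_eq_iff)
  then show ?thesis
    by (simp add: commutant_def cops_def)
qed

lemma commutant_closed:
  shows zero_in_commutant: "0 \<in> commutant N"
    and id_in_commutant: "id_blinfun \<in> commutant N"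
    and add_in_commutant: "S \<in> commutant N \<Longrightarrow> T \<in> commutant N \<Longrightarrow> S + T \<in> commutant N"
    and diff_in_commutant: "S \<in> commutant N \<Longrightarrow> T \<in> commutant N \<Longrightarrow> S - T \<in> commutant N"
    and compose_in_commutant: "S \<in> commutant N \<Longrightarrow> T \<in> commutant N \<Longrightarrow> S o\<^sub>L T \<in> commutant N"
  by (auto simp: commutant_iff blinfun.add_left blinfun.diff_left blinfun.add_right
       blinfun.diff_right scaleC_add_right complex_vector.scale_right_diff_distrib)

text \<open>\<open>M\<close> is the commutant of \<open>commutant M\<close>, so it inherits every
  closure property of commutants, including the one under strong limits of sequences.\<close>

lemma von_neumann_algebraD:
  assumes "von_neumann_algebra M"
  shows "T \<in> M \<Longrightarrow> T \<in> cops" and "0 \<in> M" and "id_blinfun \<in> M"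
    and "S \<in> M \<Longrightarrow> T \<in> M \<Longrightarrow> S + T \<in> M"
    and "S \<in> M \<Longrightarrow> T \<in> M \<Longrightarrow> S - T \<in> M"
    and "S \<in> M \<Longrightarrow> T \<in> M \<Longrightarrow> S o\<^sub>L T \<in> M"
    and "(\<And>n. A n \<in> M) \<Longrightarrow>
      (\<And>x. (\<lambda>n. blinfun_apply (A n) x) \<longlonglongrightarrow> blinfun_apply R x) \<Longrightarrow> R \<in> M"
proof -
  have eq: "commutant (commutant M) = M" and sub: "M \<subseteq> cops"
    using assms by (auto simp: von_neumann_algebra_def)
  show "T \<in> M \<Longrightarrow> T \<in> cops" using sub by auto
  note c = commutant_closed[where N = "commutant M", unfolded eq]
  show "0 \<in> M" "id_blinfun \<in> M" "S \<in> M \<Longrightarrow> T \<in> M \<Longrightarrow> S + T \<in> M"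
    "S \<in> M \<Longrightarrow> T \<in> M \<Longrightarrow> S - T \<in> M" "S \<in> M \<Longrightarrow> T \<in> M \<Longrightarrow> S o\<^sub>L T \<in> M"
    by (fact c)+
  show "(\<And>n. A n \<in> M) \<Longrightarrow>
      (\<And>x. (\<lambda>n. blinfun_apply (A n) x) \<longlonglongrightarrow> blinfun_apply R x) \<Longrightarrow> R \<in> M"
    by (rule commutant_limit[where N = "commutant M", unfolded eq])
qed

section \<open>States, the operator order and normality\<close>

lemma state_diff:
  assumes "von_neumann_algebra M" "state M \<tau>" "S \<in> M" "T \<in> M"
  shows "\<tau> (S - T) = \<tau> S - \<tau> T"
proof -
  have "\<tau> ((S - T) + T) = \<tau> (S - T) + \<tau> T"
    using assms(2,4) von_neumann_algebraD(5)[OF assms(1,3,4)] unfolding state_def by blast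
  then show ?thesis by simp
qed

lemma state_mono:
  assumes "von_neumann_algebra M" "state M \<tau>" "S \<in> M" "T \<in> M" "op_le S T"
  shows "Re (\<tau> S) \<le> Re (\<tau> T)"
proof -
  have "\<tau> (T - S) \<in> \<real>\<^sub>\<ge>\<^sub>0"
    using assms(2,5) von_neumann_algebraD(5)[OF assms(1,4,3)]
    unfolding state_def op_le_def by blast
  then show ?thesis
    by (simp add: state_diff[OF assms(1,2,4,3)] complex_nonneg_Reals_iff)
qed

lemma state_sum:
  assumes M: "von_neumann_algebra M" and \<tau>: "state M \<tau>" and "finite I" "\<And>i. i \<in> I \<Longrightarrow> f i \<in> M"
  shows "(\<Sum>i\<in>I. f i) \<in> M \<and> \<tau> (\<Sum>i\<in>I. f i) = (\<Sum>i\<in>I. \<tau> (f i))"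
  using assms(3,4)
proof induction
  case empty
  have "\<tau> (0 - 0) = 0"
    using state_diff[OF M \<tau> von_neumann_algebraD(2,2)[OF M]] by simp
  then show ?case
    by (simp add: von_neumann_algebraD(2)[OF M])
next
  case (insert i I)
  then have "\<tau> (f i + sum f I) = \<tau> (f i) + \<tau> (sum f I)"
    using \<tau> by (simp add: state_def)
  with insert show ?case
    by (simp add: von_neumann_algebraD(4)[OF M])
qed

lemma op_le_trans:
  assumes "op_le R S" "op_le S T" shows "op_le R T"
proof -
  have "positive_op (A + B)" if "positive_op A" "positive_op B" for A B :: "'a \<Rightarrow>\<^sub>L 'a"
    using that unfolding positive_op_iff
    by (auto simp: cops_def blinfun.add_left scaleC_add_right inner_add_left)
  from this[of "T - S" "S - R"] show ?thesis
    using assms by (simp add: op_le_def)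
qed

lemma op_le_refl: "op_le T T"
  by (simp add: op_le_def positive_op_iff cops_def)

text \<open>Normality is stated for directed families; this is its sequential form. The range of
  \<open>A\<close> is directed, the strong limit \<open>T\<close> is its least upper bound in
  \<open>M\<close>, and an increasing bounded real sequence tends to its supremum.\<close>

lemma normal_functional_tendsto:
  assumes M: "von_neumann_algebra M" and \<tau>: "state M \<tau>" and normal: "normal_functional M \<tau>"
    and A: "\<And>n. A n \<in> M" "\<And>n. positive_op (A n)" "\<And>n. op_le (A n) (A (Suc n))"
    and lim: "\<And>x. (\<lambda>n. blinfun_apply (A n) x) \<longlonglongrightarrow> blinfun_apply T x"
  shows "(\<lambda>n. Re (\<tau> (A n))) \<longlonglongrightarrow> Re (\<tau> T)"
proof -
  have T: "T \<in> M"
    using von_neumann_algebraD(7)[OF M A(1) lim] .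
  have mono: "op_le (A m) (A n)" if "m \<le> n" for m n
    using that by (induction rule: dec_induct) (auto intro: op_le_refl op_le_trans A(3))
  \<comment> \<open>Positivity is a pair of closed conditions on each vector, so it passes to strong
    limits. Eventual positivity is assumed because \<open>A k - A n\<close> is known to be positive
    only for \<open>k \<ge> n\<close>.\<close>
  have pos_limit: "positive_op (B - C)"
    if "\<forall>\<^sub>F n in sequentially. positive_op (B' n - C' n)" "B - C \<in> cops"
      "\<And>x. (\<lambda>n. blinfun_apply (B' n) x) \<longlonglongrightarrow> blinfun_apply B x"
      "\<And>x. (\<lambda>n. blinfun_apply (C' n) x) \<longlonglongrightarrow> blinfun_apply C x"
    for B C :: "'a \<Rightarrow>\<^sub>L 'a" and B' C'
    unfolding positive_op_iff
  proof (intro conjI allI)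
    fix x
    have l: "(\<lambda>n. blinfun_apply (B' n - C' n) x) \<longlonglongrightarrow> blinfun_apply (B - C) x"
      unfolding blinfun.diff_left by (intro tendsto_intros that)
    show "0 \<le> inner (blinfun_apply (B - C) x) x"
    proof (rule tendsto_lowerbound[OF tendsto_inner[OF l tendsto_const]])
      show "\<forall>\<^sub>F n in sequentially. 0 \<le> inner (blinfun_apply (B' n - C' n) x) x"
        using that(1) by (rule eventually_mono) (simp add: positive_op_iff)
    qed simp
    have "(\<lambda>n. inner (\<i> *\<^sub>C blinfun_apply (B' n - C' n) x) x) \<longlonglongrightarrow> inner (\<i> *\<^sub>C blinfun_apply (B - C) x) x"
      by (intro tendsto_inner tendsto_const bounded_linear.tendsto[OF bounded_linear_scaleC] l)
    moreover have "(\<lambda>n. inner (\<i> *\<^sub>C blinfun_apply (B' n - C' n) x) x) \<longlonglongrightarrow> 0"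
      by (rule tendsto_eventually, rule eventually_mono[OF that(1)]) (simp add: positive_op_iff)
    ultimately show "inner (\<i> *\<^sub>C blinfun_apply (B - C) x) x = 0"
      by (rule LIMSEQ_unique)
  qed (use that in auto)
  note D = von_neumann_algebraD(1)[OF M von_neumann_algebraD(5)[OF M]]
  have upper: "op_le (A n) T" for n
    unfolding op_le_def
    by (rule pos_limit[where B' = A and C' = "\<lambda>_. A n"])
       (use mono in \<open>auto intro!: eventually_sequentiallyI D T A lim simp: op_le_def\<close>)
  have "op_le T S" if "S \<in> M" "\<forall>n. op_le (A n) S" for S
    unfolding op_le_def
    by (rule pos_limit[where B' = "\<lambda>_. S" and C' = A])
       (use that in \<open>auto intro!: D T A lim simp: op_le_def\<close>)
  then have lub: "is_lub_in M (range A) T"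
    using T upper by (auto simp: is_lub_in_def)
  have "upward_directed (range A)"
    unfolding upward_directed_def
  proof (intro conjI ballI)
    fix B C assume "B \<in> range A" "C \<in> range A"
    then obtain m n where "B = A m" "C = A n" by blast
    then have "op_le B (A (max m n))" "op_le C (A (max m n))"
      by (simp_all add: mono)
    then show "\<exists>D\<in>range A. op_le B D \<and> op_le C D" by blast
  qed simp
  moreover have "range A \<subseteq> {B \<in> M. positive_op B}"
    using A by auto
  ultimately have "Re (\<tau> T) = (SUP B\<in>range A. Re (\<tau> B))"
    using normal[unfolded normal_functional_def, rule_format, of "range A" T] lub by simp
  then have "Re (\<tau> T) = (SUP n. Re (\<tau> (A n)))"
    by (simp add: image_image)
  moreover have "(\<lambda>n. Re (\<tau> (A n))) \<longlonglongrightarrow> (SUP n. Re (\<tau> (A n)))"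
  proof (rule LIMSEQ_incseq_SUP)
    show "bdd_above (range (\<lambda>n. Re (\<tau> (A n))))"
      by (rule bdd_aboveI2[where M = "Re (\<tau> T)"]) (intro state_mono[OF M \<tau>] A T upper)
    show "incseq (\<lambda>n. Re (\<tau> (A n)))"
      by (intro incseq_SucI state_mono[OF M \<tau>] A)
  qed
  ultimately show ?thesis by simp
qed

section \<open>Monotone convergence of operators\<close>

text \<open>Expand \<open>\<langle>D(x - Dx), x - Dx\<rangle> \<ge> 0\<close> and use \<open>\<langle>DDx, Dx\<rangle> \<le> \<langle>Dx, Dx\<rangle>\<close>.\<close>

lemma norm_sq_le_inner:
  assumes sym: "\<And>x y. inner (blinfun_apply D x) y = inner x (blinfun_apply D y)"
    and pos: "\<And>x. 0 \<le> inner (blinfun_apply D x) x"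
    and le: "\<And>x. inner (blinfun_apply D x) x \<le> inner x x"
  shows "(norm (blinfun_apply D x))\<^sup>2 \<le> inner (blinfun_apply D x) x"
proof -
  let ?y = "blinfun_apply D x"
  have "0 \<le> inner (blinfun_apply D (x - ?y)) (x - ?y)" by (rule pos)
  also have "\<dots> = inner ?y x - 2 * inner ?y ?y + inner (blinfun_apply D ?y) ?y"
    using sym[of ?y x] by (simp add: blinfun.diff_right inner_diff_left inner_diff_right inner_commute)
  also have "\<dots> \<le> inner ?y x - 2 * inner ?y ?y + inner ?y ?y"
    using le[of ?y] by simp
  finally show ?thesis by (simp add: power2_norm_eq_inner)
qed

text \<open>Vigier's theorem for sequences. For each \<open>x\<close> the numbers
  \<open>inner (A n x) x\<close> increase and are bounded by \<open>inner x x\<close>, hence form a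
  Cauchy sequence; \<open>norm_sq_le_inner\<close>, applied to \<open>A m - A n\<close>, which lies
  between 0 and 1, makes the vectors \<open>A n x\<close> Cauchy as well.\<close>

lemma monotone_strong_limit:
  fixes A :: "nat \<Rightarrow> 'h::complex_hilbert \<Rightarrow>\<^sub>L 'h"
  assumes sym: "\<And>n x y. inner (blinfun_apply (A n) x) y = inner x (blinfun_apply (A n) y)"
    and pos: "\<And>x. 0 \<le> inner (blinfun_apply (A 0) x) x"
    and mono: "\<And>n x. inner (blinfun_apply (A n) x) x \<le> inner (blinfun_apply (A (Suc n)) x) x"
    and le: "\<And>n x. inner (blinfun_apply (A n) x) x \<le> inner x x"
  obtains T where "\<And>x. (\<lambda>n. blinfun_apply (A n) x) \<longlonglongrightarrow> blinfun_apply T x"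
    and "\<And>x y. inner (blinfun_apply T x) y = inner x (blinfun_apply T y)"
proof -
  have inc: "incseq (\<lambda>n. inner (blinfun_apply (A n) x) x)" for x
    by (intro incseq_SucI mono)
  have pos': "0 \<le> inner (blinfun_apply (A n) x) x" for n x
    using pos[of x] incseqD[OF inc, of 0 n x] by simp
  have contr: "norm (blinfun_apply (A n) x) \<le> norm x" for n x
  proof -
    have "(norm (blinfun_apply (A n) x))\<^sup>2 \<le> inner (blinfun_apply (A n) x) x"
      by (rule norm_sq_le_inner[OF sym pos' le])
    also have "\<dots> \<le> inner x x" by (rule le)
    finally show ?thesis
      by (simp flip: power2_norm_eq_inner)
  qed
  have diff: "(norm (blinfun_apply (A m) x - blinfun_apply (A n) x))\<^sup>2
      \<le> inner (blinfun_apply (A m) x) x - inner (blinfun_apply (A n) x) x" if "n \<le> m" for m n x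
  proof -
    have "(norm (blinfun_apply (A m - A n) x))\<^sup>2 \<le> inner (blinfun_apply (A m - A n) x) x"
    proof (rule norm_sq_le_inner)
      show "inner (blinfun_apply (A m - A n) x) y = inner x (blinfun_apply (A m - A n) y)" for x y
        by (simp add: blinfun.diff_left inner_diff_left inner_diff_right sym)
      show "0 \<le> inner (blinfun_apply (A m - A n) x) x" for x
        using incseqD[OF inc that, of x] by (simp add: blinfun.diff_left inner_diff_left)
      show "inner (blinfun_apply (A m - A n) x) x \<le> inner x x" for x
        using le[of m x] pos'[of n x] by (simp add: blinfun.diff_left inner_diff_left)
    qed
    then show ?thesis by (simp add: blinfun.diff_left inner_diff_left)
  qed
  have conv: "convergent (\<lambda>n. blinfun_apply (A n) x)" for x
  proof (rule Cauchy_convergent, rule CauchyI)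
    fix \<epsilon> :: real assume "\<epsilon> > 0"
    have "Bseq (\<lambda>n. inner (blinfun_apply (A n) x) x)"
      by (rule BseqI'[where K = "inner x x"]) (use pos' le in auto)
    then have "Cauchy (\<lambda>n. inner (blinfun_apply (A n) x) x)"
      using inc by (intro convergent_Cauchy Bseq_mono_convergent) (auto simp: incseq_def)
    then obtain N where N: "\<And>m n. m \<ge> N \<Longrightarrow> n \<ge> N \<Longrightarrow>
        norm (inner (blinfun_apply (A m) x) x - inner (blinfun_apply (A n) x) x) < \<epsilon>\<^sup>2"
      using \<open>\<epsilon> > 0\<close> CauchyD[of "\<lambda>n. inner (blinfun_apply (A n) x) x" "\<epsilon>\<^sup>2"] by auto
    have main: "norm (blinfun_apply (A m) x - blinfun_apply (A n) x) < \<epsilon>" if "n \<ge> N" "n \<le> m" for m n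
    proof -
      have "(norm (blinfun_apply (A m) x - blinfun_apply (A n) x))\<^sup>2 < \<epsilon>\<^sup>2"
        using diff[OF that(2), of x] N[of m n] that by auto
      then show ?thesis
        by (rule power_less_imp_less_base) (use \<open>\<epsilon> > 0\<close> in simp)
    qed
    have "norm (blinfun_apply (A m) x - blinfun_apply (A n) x) < \<epsilon>" if "m \<ge> N" "n \<ge> N" for m n
      using main[of m n] main[of n m] that by (cases "n \<le> m") (auto simp: norm_minus_commute)
    then show "\<exists>N. \<forall>m\<ge>N. \<forall>n\<ge>N. norm (blinfun_apply (A m) x - blinfun_apply (A n) x) < \<epsilon>"
      by blast
  qed
  define L where "L x = lim (\<lambda>n. blinfun_apply (A n) x)" for x
  have L: "(\<lambda>n. blinfun_apply (A n) x) \<longlonglongrightarrow> L x" for x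
    using conv unfolding L_def by (simp add: convergent_LIMSEQ_iff)
  have "bounded_linear L"
  proof (rule bounded_linear_intro[where K = 1])
    show "L (x + y) = L x + L y" for x y
      by (rule LIMSEQ_unique[OF L]) (simp add: blinfun.add_right tendsto_add L)
    show "L (r *\<^sub>R x) = r *\<^sub>R L x" for r x
      by (rule LIMSEQ_unique[OF L]) (simp add: blinfun.scaleR_right tendsto_scaleR L)
    show "norm (L x) \<le> norm x * 1" for x
      by (rule tendsto_upperbound[OF tendsto_norm[OF L]]) (simp_all add: contr)
  qed
  then have apply_L: "blinfun_apply (Blinfun L) = L"
    by (rule bounded_linear_Blinfun_apply)
  show ?thesis
  proof
    show "(\<lambda>n. blinfun_apply (A n) x) \<longlonglongrightarrow> blinfun_apply (Blinfun L) x" for x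
      using L apply_L by simp
    show "inner (blinfun_apply (Blinfun L) x) y = inner x (blinfun_apply (Blinfun L) y)" for x y
      unfolding apply_L
    proof (rule LIMSEQ_unique)
      show "(\<lambda>n. inner (blinfun_apply (A n) x) y) \<longlonglongrightarrow> inner (L x) y"
        by (intro tendsto_intros L)
      show "(\<lambda>n. inner (blinfun_apply (A n) x) y) \<longlonglongrightarrow> inner x (L y)"
        unfolding sym by (intro tendsto_intros L)
    qed
  qed
qed

section \<open>Projections and their order\<close>

lemma projectionsI:
  assumes "von_neumann_algebra M" "T \<in> M"
    and "\<And>x y. inner (blinfun_apply T x) y = inner x (blinfun_apply T y)"
    and "\<And>x. blinfun_apply T (blinfun_apply T x) = blinfun_apply T x"
  shows "T \<in> projections M"
  using assms self_adjointI[OF von_neumann_algebraD(1)[OF assms(1,2)] assms(3)]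
  by (auto simp: projections_def intro!: blinfun_eqI)

lemma projectionsD:
  assumes "p \<in> projections M"
  shows "p \<in> M"
    and "inner (blinfun_apply p x) y = inner x (blinfun_apply p y)"
    and "blinfun_apply p (blinfun_apply p x) = blinfun_apply p x"
    and "inner (blinfun_apply p x) x = (norm (blinfun_apply p x))\<^sup>2"
    and "(norm (x - blinfun_apply p x))\<^sup>2 = (norm x)\<^sup>2 - (norm (blinfun_apply p x))\<^sup>2"
    and "norm (blinfun_apply p x) \<le> norm x"
    and "norm (x - blinfun_apply p x) \<le> norm x"
proof -
  show "p \<in> M" using assms by (simp add: projections_def)
  show sym: "inner (blinfun_apply p x) y = inner x (blinfun_apply p y)" for x y
    using assms by (intro self_adjoint_inner) (simp add: projections_def)
  have "p o\<^sub>L p = p" using assms by (simp add: projections_def)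
  then show idem: "blinfun_apply p (blinfun_apply p x) = blinfun_apply p x" for x
    by (metis blinfun_apply_blinfun_compose)
  show eq: "inner (blinfun_apply p x) x = (norm (blinfun_apply p x))\<^sup>2"
    using sym[of "blinfun_apply p x" x] by (simp add: idem power2_norm_eq_inner)
  show split: "(norm (x - blinfun_apply p x))\<^sup>2 = (norm x)\<^sup>2 - (norm (blinfun_apply p x))\<^sup>2"
    using eq by (simp add: power2_norm_eq_inner inner_diff_left inner_diff_right inner_commute)
  have "(norm (blinfun_apply p x))\<^sup>2 \<le> (norm x)\<^sup>2"
    using zero_le_power2[of "norm (x - blinfun_apply p x)"] unfolding split by simp
  then show "norm (blinfun_apply p x) \<le> norm x"
    by (rule power2_le_imp_le) simp
  have "(norm (x - blinfun_apply p x))\<^sup>2 \<le> (norm x)\<^sup>2"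
    unfolding split by simp
  then show "norm (x - blinfun_apply p x) \<le> norm x"
    by (rule power2_le_imp_le) simp
qed

lemma op_leI:
  assumes M: "von_neumann_algebra M" and "S \<in> M" "T \<in> M"
    and sym: "\<And>x y. inner (blinfun_apply S x) y = inner x (blinfun_apply S y)"
      "\<And>x y. inner (blinfun_apply T x) y = inner x (blinfun_apply T y)"
    and le: "\<And>x. inner (blinfun_apply S x) x \<le> inner (blinfun_apply T x) x"
  shows "op_le S T"
proof -
  have *: "T - S \<in> cops"
    using assms(2,3) M by (blast intro: von_neumann_algebraD)
  show ?thesis
    unfolding op_le_def
    by (intro self_adjoint_positive_opI * self_adjointI)
       (simp_all add: blinfun.diff_left inner_diff_left inner_diff_right sym le[unfolded sym])
qed

section \<open>Powers of operators and a trace bound from minimality\<close>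

primrec opow :: "('h::complex_hilbert \<Rightarrow>\<^sub>L 'h) \<Rightarrow> nat \<Rightarrow> 'h \<Rightarrow>\<^sub>L 'h" where
  "opow b 0 = id_blinfun"
| "opow b (Suc n) = b o\<^sub>L opow b n"

lemma opow_add: "blinfun_apply (opow b (m + n)) x = blinfun_apply (opow b m) (blinfun_apply (opow b n) x)"
  by (induction m) auto

lemma opow_in:
  assumes "von_neumann_algebra M" "b \<in> M"
  shows "opow b n \<in> M"
  by (induction n) (simp_all add: assms von_neumann_algebraD(3,6)[OF assms(1)])

lemma opow_sym:
  assumes "\<And>x y. inner (blinfun_apply b x) y = inner x (blinfun_apply b y)"
  shows "inner (blinfun_apply (opow b n) x) y = inner x (blinfun_apply (opow b n) y)"
proof (induction n arbitrary: x y)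
  case (Suc n)
  have "blinfun_apply (opow b n) (blinfun_apply b y) = blinfun_apply b (blinfun_apply (opow b n) y)"
    using opow_add[of b n 1 y] opow_add[of b 1 n y] by simp
  then show ?case
    by (simp add: assms Suc)
qed simp

text \<open>One half of an even power moves to the other side of the inner product. This is why the
  approximants of the support projection below use the exponents \<open>n + n\<close>.\<close>

lemma opow_double_inner:
  assumes "\<And>x y. inner (blinfun_apply b x) y = inner x (blinfun_apply b y)"
  shows "inner (blinfun_apply (opow b (n + n)) x) x = (norm (blinfun_apply (opow b n) x))\<^sup>2"
  by (simp add: opow_add opow_sym[OF assms] power2_norm_eq_inner)

text \<open>Passing from \<open>n\<close> to \<open>Suc n\<close> subtracts the trace of
  \<open>X Y (1 - X Y)^n\<close>. Cyclicity carries the leading \<open>X\<close> to the right end,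
  where \<open>(1 - X Y)^n X = X (1 - Y X)^n\<close> turns the term into
  \<open>Y X (1 - Y X)^n\<close>.\<close>

lemma tracial_opow_commute:
  assumes M: "von_neumann_algebra M" and \<tau>: "tracial_state M \<tau>" and X: "X \<in> M" and Y: "Y \<in> M"
  shows "\<tau> (opow (id_blinfun - (X o\<^sub>L Y)) n) = \<tau> (opow (id_blinfun - (Y o\<^sub>L X)) n)"
proof -
  have st: "state M \<tau>" and tr: "\<And>S T. S \<in> M \<Longrightarrow> T \<in> M \<Longrightarrow> \<tau> (S o\<^sub>L T) = \<tau> (T o\<^sub>L S)"
    using \<tau> by (auto simp: tracial_state_def)
  note closed = X Y opow_in[OF M] von_neumann_algebraD(3,5,6)[OF M]
  let ?c = "id_blinfun - (X o\<^sub>L Y)" and ?b = "id_blinfun - (Y o\<^sub>L X)"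
  have step: "opow (id_blinfun - V) (Suc n) = opow (id_blinfun - V) n - (V o\<^sub>L opow (id_blinfun - V) n)"
    for V :: "'a \<Rightarrow>\<^sub>L 'a" and n
    by (rule blinfun_eqI) (simp add: blinfun.diff_left)
  have swap: "opow ?c n o\<^sub>L X = X o\<^sub>L opow ?b n" for n
  proof (rule blinfun_eqI)
    show "blinfun_apply (opow ?c n o\<^sub>L X) x = blinfun_apply (X o\<^sub>L opow ?b n) x" for x
      by (induction n) (simp_all add: blinfun.diff_left blinfun.diff_right)
  qed
  show ?thesis
  proof (induction n)
    case (Suc n)
    have "\<tau> ((X o\<^sub>L Y) o\<^sub>L opow ?c n) = \<tau> (X o\<^sub>L (Y o\<^sub>L opow ?c n))"
      by (rule arg_cong[of _ _ \<tau>], rule blinfun_eqI) simp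
    also have "\<dots> = \<tau> ((Y o\<^sub>L opow ?c n) o\<^sub>L X)"
      by (intro tr closed)
    also have "(Y o\<^sub>L opow ?c n) o\<^sub>L X = Y o\<^sub>L (opow ?c n o\<^sub>L X)"
      by (rule blinfun_eqI) simp
    also have "\<dots> = (Y o\<^sub>L X) o\<^sub>L opow ?b n"
      unfolding swap by (rule blinfun_eqI) simp
    finally have "\<tau> ((X o\<^sub>L Y) o\<^sub>L opow ?c n) = \<tau> ((Y o\<^sub>L X) o\<^sub>L opow ?b n)" .
    moreover have "\<tau> (opow ?c (Suc n)) = \<tau> (opow ?c n) - \<tau> ((X o\<^sub>L Y) o\<^sub>L opow ?c n)"
      unfolding step by (intro state_diff[OF M st] closed)
    moreover have "\<tau> (opow ?b (Suc n)) = \<tau> (opow ?b n) - \<tau> ((Y o\<^sub>L X) o\<^sub>L opow ?b n)"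
      unfolding step by (intro state_diff[OF M st] closed)
    ultimately show ?case using Suc by metis
  qed simp
qed

text \<open>
  With \<open>b = 1 - epe\<close>, the operators \<open>1 - b\<^sup>2\<^sup>n\<close> increase strongly to the support projection of \<open>epe\<close>,
  which is \<open>e\<close> by minimality, while the trace property turns \<open>\<tau>(1 - (1 - epe)\<^sup>2\<^sup>n)\<close> into
  \<open>\<tau>(1 - (1 - pep)\<^sup>2\<^sup>n) \<le> \<tau>(p)\<close>. This replaces the polar decomposition of \<open>pe\<close>.
\<close>

lemma minimal_projection_trace_le:
  assumes M: "von_neumann_algebra M" and \<tau>: "tracial_state M \<tau>" and normal: "normal_functional M \<tau>"
    and minimal: "minimal_projection M e" and p: "p \<in> projections M" and pe: "p o\<^sub>L e \<noteq> 0"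
  shows "Re (\<tau> e) \<le> Re (\<tau> p)"
proof -
  have st: "state M \<tau>" and one: "\<tau> id_blinfun = 1"
    using \<tau> by (auto simp: tracial_state_def state_def)
  have e: "e \<in> projections M"
    using minimal by (simp add: minimal_projection_def)
  note p' = projectionsD[OF p] and e' = projectionsD[OF e]
  note closed = p'(1) e'(1) opow_in[OF M] von_neumann_algebraD(3,5,6)[OF M]
  \<comment> \<open>Up to idempotence these are \<open>1 - epe\<close> and \<open>1 - pep\<close>.
    The factored form matches \<open>tracial_opow_commute\<close> with \<open>X = e p\<close> and
    \<open>Y = p e\<close>.\<close>
  define b where "b = id_blinfun - ((e o\<^sub>L p) o\<^sub>L (p o\<^sub>L e))"
  define c where "c = id_blinfun - ((p o\<^sub>L e) o\<^sub>L (e o\<^sub>L p))"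
  have bM: "b \<in> M" and cM: "c \<in> M"
    unfolding b_def c_def by (intro closed)+
  have b: "blinfun_apply b x = x - blinfun_apply e (blinfun_apply p (blinfun_apply e x))" for x
    by (simp add: b_def blinfun.diff_left p')
  have c: "blinfun_apply c x = x - blinfun_apply p (blinfun_apply e (blinfun_apply p x))" for x
    by (simp add: c_def blinfun.diff_left e')
  have b_sym: "inner (blinfun_apply b x) y = inner x (blinfun_apply b y)" for x y
    by (simp add: b inner_diff_left inner_diff_right e' p')
  have c_sym: "inner (blinfun_apply c x) y = inner x (blinfun_apply c y)" for x y
    by (simp add: c inner_diff_left inner_diff_right e' p')
  \<comment> \<open>A quantitative contraction: applying \<open>b\<close> costs at least the squared
    norm of \<open>p e x\<close>, so a vector that loses no norm is annihilated by
    \<open>p e\<close>.\<close>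
  have b_contr: "(norm (blinfun_apply b x))\<^sup>2 \<le> (norm x)\<^sup>2 - (norm (blinfun_apply p (blinfun_apply e x)))\<^sup>2" for x
  proof -
    let ?y = "blinfun_apply p (blinfun_apply e x)"
    have "inner (blinfun_apply e ?y) x = (norm ?y)\<^sup>2"
      by (simp add: e'(2) p'(4))
    then have "(norm (blinfun_apply b x))\<^sup>2 = (norm x)\<^sup>2 - 2 * (norm ?y)\<^sup>2 + (norm (blinfun_apply e ?y))\<^sup>2"
      by (simp add: b power2_norm_eq_inner inner_diff_left inner_diff_right inner_commute)
    moreover have "(norm (blinfun_apply e ?y))\<^sup>2 \<le> (norm ?y)\<^sup>2"
      by (intro power_mono e') simp
    ultimately show ?thesis by simp
  qed
  have b_norm: "(norm (blinfun_apply b x))\<^sup>2 \<le> (norm x)\<^sup>2" for x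
    using b_contr[of x] zero_le_power2[of "norm (blinfun_apply p (blinfun_apply e x))"] by linarith
  define A where "A n = id_blinfun - opow b (n + n)" for n
  have A: "blinfun_apply (A n) x = x - blinfun_apply (opow b (n + n)) x" for n x
    by (simp add: A_def blinfun.diff_left)
  have AM: "A n \<in> M" for n
    unfolding A_def by (intro closed bM)
  have A_sym: "inner (blinfun_apply (A n) x) y = inner x (blinfun_apply (A n) y)" for n x y
    by (simp add: A inner_diff_left inner_diff_right opow_sym[OF b_sym])
  have A_inner: "inner (blinfun_apply (A n) x) x = (norm x)\<^sup>2 - (norm (blinfun_apply (opow b n) x))\<^sup>2" for n x
    by (simp add: A inner_diff_left opow_double_inner[OF b_sym] power2_norm_eq_inner)
  have A_mono: "inner (blinfun_apply (A n) x) x \<le> inner (blinfun_apply (A (Suc n)) x) x" for n x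
    by (simp add: A_inner b_norm)
  have A_pos: "0 \<le> inner (blinfun_apply (A n) x) x" for n x
  proof (induction n)
    case (Suc n)
    then show ?case using A_mono[of n x] by linarith
  qed (simp add: A)
  obtain T where lim: "\<And>x. (\<lambda>n. blinfun_apply (A n) x) \<longlonglongrightarrow> blinfun_apply T x"
    and T_sym: "\<And>x y. inner (blinfun_apply T x) y = inner x (blinfun_apply T y)"
  proof (rule monotone_strong_limit[of A])
    show "inner (blinfun_apply (A n) x) x \<le> inner x x" for n x
      by (simp add: A_inner flip: power2_norm_eq_inner)
  qed (use A_sym A_pos A_mono in auto)
  have TM: "T \<in> M"
    by (rule von_neumann_algebraD(7)[OF M AM lim])
  \<comment> \<open>The vector \<open>z\<close> is the limit of \<open>b^(2n) x\<close>. Shifting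
    \<open>n\<close> by one applies \<open>b\<close> twice, so \<open>b (b z) = z\<close>; hence
    \<open>b\<close> loses no norm at \<open>z\<close>, and \<open>b_contr\<close> gives
    \<open>p e z = 0\<close>.\<close>
  have peQ: "blinfun_apply p (blinfun_apply e (x - blinfun_apply T x)) = 0" for x
  proof -
    define z where "z = x - blinfun_apply T x"
    have z: "(\<lambda>n. blinfun_apply (opow b (n + n)) x) \<longlonglongrightarrow> z"
      using tendsto_diff[OF tendsto_const lim, of x x] by (simp add: z_def A)
    have "(\<lambda>n. blinfun_apply b (blinfun_apply b (blinfun_apply (opow b (n + n)) x)))
        \<longlonglongrightarrow> blinfun_apply b (blinfun_apply b z)"
      by (intro tendsto_intros z)
    moreover have "(\<lambda>n. blinfun_apply b (blinfun_apply b (blinfun_apply (opow b (n + n)) x))) \<longlonglongrightarrow> z"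
      using LIMSEQ_Suc[OF z] by simp
    ultimately have "blinfun_apply b (blinfun_apply b z) = z"
      by (rule LIMSEQ_unique)
    then have "(norm z)\<^sup>2 \<le> (norm (blinfun_apply b z))\<^sup>2"
      using b_norm[of "blinfun_apply b z"] by simp
    then have "(norm (blinfun_apply p (blinfun_apply e z)))\<^sup>2 \<le> 0"
      using b_contr[of z] by linarith
    then show ?thesis by (simp add: z_def)
  qed
  \<comment> \<open>All powers of \<open>b\<close> fix such a \<open>z\<close>, so every
    \<open>A n\<close> annihilates it. Taking \<open>x - T x\<close> for \<open>z\<close> will show
    that \<open>T\<close> is idempotent, and taking \<open>x - e x\<close> that
    \<open>T e = T\<close>.\<close>
  have T_fixed: "blinfun_apply T z = 0" if "blinfun_apply b z = z" for z
  proof (rule LIMSEQ_unique[OF lim])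
    have "blinfun_apply (opow b n) z = z" for n
      by (induction n) (simp_all add: that)
    then show "(\<lambda>n. blinfun_apply (A n) z) \<longlonglongrightarrow> 0"
      by (simp add: A)
  qed
  have "blinfun_apply T (x - blinfun_apply T x) = 0" for x
    by (rule T_fixed) (simp add: b peQ)
  then have T_idem: "blinfun_apply T (blinfun_apply T x) = blinfun_apply T x" for x
    by (simp add: blinfun.diff_right)
  have T: "T \<in> projections M"
    by (rule projectionsI[OF M TM T_sym T_idem])
  have "blinfun_apply T (x - blinfun_apply e x) = 0" for x
    by (rule T_fixed) (simp add: b blinfun.diff_right e')
  then have Te: "blinfun_apply T (blinfun_apply e x) = blinfun_apply T x" for x
    by (simp add: blinfun.diff_right)
  have "op_le T e"
  proof (rule op_leI[OF M TM e'(1) T_sym e'(2)])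
    fix x
    have "(norm (blinfun_apply T (blinfun_apply e x)))\<^sup>2 \<le> (norm (blinfun_apply e x))\<^sup>2"
      by (intro power_mono projectionsD[OF T]) simp
    then show "inner (blinfun_apply T x) x \<le> inner (blinfun_apply e x) x"
      by (simp add: projectionsD(4)[OF T] e'(4) Te)
  qed
  \<comment> \<open>If \<open>T\<close> were 0, \<open>peQ\<close> would say that \<open>p e\<close>
    vanishes at every vector.\<close>
  moreover have "T \<noteq> 0"
    using peQ pe by (auto intro!: blinfun_eqI)
  ultimately have "T = e"
    using minimal T by (auto simp: minimal_projection_def)
  have "(\<lambda>n. Re (\<tau> (A n))) \<longlonglongrightarrow> Re (\<tau> e)"
    unfolding \<open>T = e\<close>[symmetric]
  proof (rule normal_functional_tendsto[OF M st normal AM _ _ lim])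
    show "positive_op (A n)" for n
      by (intro self_adjoint_positive_opI self_adjointI von_neumann_algebraD(1)[OF M] AM A_sym A_pos)
    show "op_le (A n) (A (Suc n))" for n
      by (intro op_leI[OF M] AM A_sym A_mono)
  qed
  moreover have "Re (\<tau> (A n)) \<le> Re (\<tau> p)" for n
  proof -
    have "\<tau> (A n) = \<tau> (id_blinfun - opow c (n + n))"
      using tracial_opow_commute[OF M \<tau>, of "e o\<^sub>L p" "p o\<^sub>L e" "n + n"] closed
      by (simp add: A_def b_def c_def state_diff[OF M st])
    also have "Re \<dots> \<le> Re (\<tau> p)"
    proof (intro state_mono[OF M st] op_leI[OF M] closed cM)
      fix x
      \<comment> \<open>The operator \<open>c\<close> changes a vector only by an element of the
        range of \<open>p\<close>, so its powers preserve the component in the range of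
        \<open>1 - p\<close>. Hence \<open>1 - p\<close> is dominated by \<open>c^(2n)\<close>, that
        is, \<open>1 - c^(2n) \<le> p\<close>.\<close>
      have "z - blinfun_apply p z = x - blinfun_apply p x" if "z = blinfun_apply (opow c k) x" for k z
        using that by (induction k arbitrary: z) (simp_all add: c blinfun.diff_right p')
      then have "x - blinfun_apply p x = blinfun_apply (opow c n) x - blinfun_apply p (blinfun_apply (opow c n) x)"
        by simp
      then have "(norm (x - blinfun_apply p x))\<^sup>2 \<le> (norm (blinfun_apply (opow c n) x))\<^sup>2"
        by (simp add: p'(7))
      then show "inner (blinfun_apply (id_blinfun - opow c (n + n)) x) x \<le> inner (blinfun_apply p x) x"
        by (simp add: blinfun.diff_left inner_diff_left opow_double_inner[OF c_sym] p'(4,5)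
            flip: power2_norm_eq_inner)
    qed (simp_all add: blinfun.diff_left inner_diff_left inner_diff_right opow_sym[OF c_sym] p')
    finally show ?thesis .
  qed
  ultimately show ?thesis
    by (intro tendsto_upperbound[where F = sequentially]) auto
qed

section \<open>Sums of orthogonal projections\<close>

text \<open>Orthogonality kills all cross terms. The case \<open>J = I\<close> of the product
  formula is idempotence; proper subsets serve to compare partial sums of a series.\<close>

lemma orthogonal_projections_sum:
  assumes M: "von_neumann_algebra M" and I: "finite I"
    and e: "\<And>i. i \<in> I \<Longrightarrow> e i \<in> projections M"
    and orth: "\<And>i j. i \<in> I \<Longrightarrow> j \<in> I \<Longrightarrow> i \<noteq> j \<Longrightarrow> e i o\<^sub>L e j = 0"
  shows "J \<subseteq> I \<Longrightarrow> blinfun_apply (\<Sum>i\<in>J. e i) (blinfun_apply (\<Sum>i\<in>I. e i) x) = blinfun_apply (\<Sum>i\<in>J. e i) x"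
    and "(\<Sum>i\<in>I. e i) \<in> projections M"
proof -
  have *: "blinfun_apply (e i) (blinfun_apply (\<Sum>j\<in>I. e j) x) = blinfun_apply (e i) x" if "i \<in> I" for i x
  proof -
    have "blinfun_apply (e i) (blinfun_apply (e j) x) = (if j = i then blinfun_apply (e i) x else 0)"
      if "j \<in> I" for j
      using orth[OF \<open>i \<in> I\<close> that] projectionsD(3)[OF e[OF that]]
      by (auto simp flip: blinfun_apply_blinfun_compose)
    then show ?thesis
      using I that by (simp add: blinfun.sum_left blinfun.sum_right)
  qed
  show mult: "blinfun_apply (\<Sum>i\<in>J. e i) (blinfun_apply (\<Sum>i\<in>I. e i) x) = blinfun_apply (\<Sum>i\<in>J. e i) x"
    if "J \<subseteq> I" for J x
    unfolding blinfun.sum_left[of e J] using * that by (intro sum.cong) auto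
  have "(\<Sum>i\<in>I. e i) \<in> M"
    using I e
  proof induction
    case (insert i I)
    then show ?case
      by (simp add: von_neumann_algebraD(4)[OF M] projectionsD(1))
  qed (simp add: von_neumann_algebraD(2)[OF M])
  then show "(\<Sum>i\<in>I. e i) \<in> projections M"
  proof (rule projectionsI[OF M])
    show "inner (blinfun_apply (\<Sum>i\<in>I. e i) x) y = inner x (blinfun_apply (\<Sum>i\<in>I. e i) y)" for x y
      by (auto simp: blinfun.sum_left inner_sum_left inner_sum_right projectionsD(2)[OF e] intro!: sum.cong)
    show "blinfun_apply (\<Sum>i\<in>I. e i) (blinfun_apply (\<Sum>i\<in>I. e i) x) = blinfun_apply (\<Sum>i\<in>I. e i) x" for x
      by (rule mult) simp
  qed
qed

text \<open>Countable additivity of the trace: the partial sums are increasing projections, so they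
  converge strongly, and normality carries the limit through \<open>\<tau>\<close>. The ranges
  \<open>{1..N}\<close> match an enumeration that starts at 1.\<close>

lemma orthogonal_projections_infinite_sum:
  fixes e :: "nat \<Rightarrow> 'h::complex_hilbert \<Rightarrow>\<^sub>L 'h"
  assumes M: "von_neumann_algebra M" and st: "state M \<tau>" and normal: "normal_functional M \<tau>"
    and e: "\<And>i. i \<in> I \<Longrightarrow> e i \<in> projections M"
    and orth: "\<And>i j. i \<in> I \<Longrightarrow> j \<in> I \<Longrightarrow> i \<noteq> j \<Longrightarrow> e i o\<^sub>L e j = 0"
  obtains T where "T \<in> projections M"
    and "\<And>x. (\<lambda>N. \<Sum>i\<in>I \<inter> {1..N}. blinfun_apply (e i) x) \<longlonglongrightarrow> blinfun_apply T x"
    and "(\<lambda>N. \<Sum>i\<in>I \<inter> {1..N}. Re (\<tau> (e i))) \<longlonglongrightarrow> Re (\<tau> T)"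
proof -
  define A where "A N = (\<Sum>i\<in>I \<inter> {1..N}. e i)" for N
  have A: "A N \<in> projections M" for N
    unfolding A_def by (rule orthogonal_projections_sum(2)[OF M]) (use e orth in auto)
  note A' = projectionsD[OF A]
  have A_mult: "blinfun_apply (A m) (blinfun_apply (A n) x) = blinfun_apply (A m) x" if "m \<le> n" for m n x
    unfolding A_def by (rule orthogonal_projections_sum(1)[OF M]) (use e orth that in auto)
  have A_mono: "inner (blinfun_apply (A n) x) x \<le> inner (blinfun_apply (A (Suc n)) x) x" for n x
  proof -
    have "(norm (blinfun_apply (A n) (blinfun_apply (A (Suc n)) x)))\<^sup>2 \<le> (norm (blinfun_apply (A (Suc n)) x))\<^sup>2"
      by (intro power_mono A') simp
    then show ?thesis
      by (simp add: A'(4) A_mult)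
  qed
  have A_le: "inner (blinfun_apply (A n) x) x \<le> inner x x" for n x
    unfolding A'(4) power2_norm_eq_inner[symmetric] by (intro power_mono A') simp
  obtain T where lim: "\<And>x. (\<lambda>n. blinfun_apply (A n) x) \<longlonglongrightarrow> blinfun_apply T x"
    and T_sym: "\<And>x y. inner (blinfun_apply T x) y = inner x (blinfun_apply T y)"
    by (rule monotone_strong_limit[of A, OF A'(2) _ A_mono A_le]) (simp add: A'(4), rule that)
  \<comment> \<open>For \<open>m \<ge> n\<close> the product \<open>A n A m\<close> is already
    \<open>A n\<close>. Letting \<open>n\<close> grow afterwards in \<open>A n T = A n\<close> gives
    \<open>T T = T\<close>.\<close>
  have AT: "blinfun_apply (A n) (blinfun_apply T x) = blinfun_apply (A n) x" for n x
  proof (rule LIMSEQ_unique)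
    show "(\<lambda>m. blinfun_apply (A n) (blinfun_apply (A m) x)) \<longlonglongrightarrow> blinfun_apply (A n) (blinfun_apply T x)"
      by (intro tendsto_intros lim)
    show "(\<lambda>m. blinfun_apply (A n) (blinfun_apply (A m) x)) \<longlonglongrightarrow> blinfun_apply (A n) x"
      by (rule tendsto_eventually) (auto intro!: eventually_sequentiallyI A_mult)
  qed
  have TM: "T \<in> M"
    by (rule von_neumann_algebraD(7)[OF M A'(1) lim])
  have "blinfun_apply T (blinfun_apply T x) = blinfun_apply T x" for x
    using lim[of "blinfun_apply T x"] lim[of x] unfolding AT by (rule LIMSEQ_unique)
  then have T: "T \<in> projections M"
    by (rule projectionsI[OF M TM T_sym])
  have "(\<lambda>n. Re (\<tau> (A n))) \<longlonglongrightarrow> Re (\<tau> T)"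
  proof (rule normal_functional_tendsto[OF M st normal A'(1) _ _ lim])
    show "positive_op (A n)" for n
      by (intro self_adjoint_positive_opI self_adjointI von_neumann_algebraD(1)[OF M] A'(1,2)) (simp add: A'(4))
    show "op_le (A n) (A (Suc n))" for n
      by (intro op_leI[OF M] A'(1,2) A_mono)
  qed
  moreover have "\<tau> (A n) = (\<Sum>i\<in>I \<inter> {1..n}. \<tau> (e i))" for n
    unfolding A_def using state_sum[OF M st, of "I \<inter> {1..n}" e] projectionsD(1)[OF e] by simp
  ultimately show ?thesis
    using that T lim by (simp add: A_def blinfun.sum_left)
qed

text \<open>From \<open>p f = 0\<close> follows \<open>p x = p (x - f x)\<close>, so the norm of
  \<open>p x\<close> is at most that of \<open>x - f x\<close>; this means
  \<open>p \<le> 1 - f\<close>.\<close>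

lemma orthogonal_projections_trace:
  assumes M: "von_neumann_algebra M" and st: "state M \<tau>"
    and p: "p \<in> projections M" and f: "f \<in> projections M" and pf: "p o\<^sub>L f = 0"
  shows "Re (\<tau> p) \<le> 1 - Re (\<tau> f)"
proof -
  note closed = projectionsD(1)[OF p] projectionsD(1)[OF f] von_neumann_algebraD(3,5)[OF M]
  have "op_le p (id_blinfun - f)"
  proof (intro op_leI[OF M] closed)
    fix x
    have "blinfun_apply p (blinfun_apply f x) = 0"
      using pf by (simp flip: blinfun_apply_blinfun_compose)
    then have "(norm (blinfun_apply p x))\<^sup>2 \<le> (norm (x - blinfun_apply f x))\<^sup>2"
      using power_mono[OF projectionsD(6)[OF p, of "x - blinfun_apply f x"], of 2]
      by (simp add: blinfun.diff_right)
    then show "inner (blinfun_apply p x) x \<le> inner (blinfun_apply (id_blinfun - f) x) x"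
      by (simp add: projectionsD(4)[OF p] projectionsD(4,5)[OF f] blinfun.diff_left inner_diff_left
          flip: power2_norm_eq_inner)
  qed (simp_all add: blinfun.diff_left inner_diff_left inner_diff_right projectionsD(2)[OF p] projectionsD(2)[OF f])
  then have "Re (\<tau> p) \<le> Re (\<tau> (id_blinfun - f))"
    by (intro state_mono[OF M st] closed)
  then show ?thesis
    using st by (simp add: state_diff[OF M st] closed state_def)
qed

section \<open>Kakeya's greedy subsums\<close>

primrec greedy :: "(nat \<Rightarrow> real) \<Rightarrow> real \<Rightarrow> nat \<Rightarrow> real" where
  "greedy t x 0 = 0"
| "greedy t x (Suc n) = (if greedy t x n + t (Suc n) \<le> x then greedy t x n + t (Suc n) else greedy t x n)"

text \<open>The greedy deficit never exceeds the tail of the series, and this tail tends to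
  0.\<close>

lemma subsum_exists:
  fixes t :: "nat \<Rightarrow> real"
  assumes total: "(\<lambda>N. \<Sum>k=1..N. t k) \<longlonglongrightarrow> s"
    and tail: "\<And>n. n \<ge> 1 \<Longrightarrow> t n \<le> s - (\<Sum>k=1..n. t k)"
    and x: "0 \<le> x" "x \<le> s"
  obtains I where "I \<subseteq> {1..}" "(\<lambda>N. \<Sum>k\<in>I \<inter> {1..N}. t k) \<longlonglongrightarrow> x"
proof -
  \<comment> \<open>The indices of the accepted terms; the form \<open>Suc n\<close> keeps 0
    out.\<close>
  define I where "I = {Suc n | n. greedy t x n + t (Suc n) \<le> x}"
  have I_Suc: "Suc n \<in> I \<longleftrightarrow> greedy t x n + t (Suc n) \<le> x" for n
    by (auto simp: I_def)
  have sum: "(\<Sum>k\<in>I \<inter> {1..N}. t k) = greedy t x N" for N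
  proof (induction N)
    case (Suc N)
    have "I \<inter> {1..Suc N} = (if Suc N \<in> I then insert (Suc N) (I \<inter> {1..N}) else I \<inter> {1..N})"
      by (auto simp: le_Suc_eq)
    with Suc show ?case
      by (simp add: I_Suc)
  qed simp
  have upper: "greedy t x n \<le> x" for n
    by (induction n) (simp_all add: x)
  \<comment> \<open>The invariant \<open>x - greedy t x n \<le> s - (\<Sum>k=1..n. t k)\<close>.
    Accepting a term lowers both sides equally; a term is rejected only if it exceeds the deficit,
    and then \<open>tail\<close> bounds it by the new right-hand side.\<close>
  have lower: "x - (s - (\<Sum>k=1..n. t k)) \<le> greedy t x n" for n
  proof (induction n)
    case (Suc n)
    then show ?case using tail[of "Suc n"] by auto
  qed (simp add: x)
  have lim: "greedy t x \<longlonglongrightarrow> x"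
  proof (rule tendsto_sandwich)
    have "(\<lambda>n. x - (s - (\<Sum>k=1..n. t k))) \<longlonglongrightarrow> x - (s - s)"
      by (intro tendsto_intros total)
    then show "(\<lambda>n. x - (s - (\<Sum>k=1..n. t k))) \<longlonglongrightarrow> x" by simp
  qed (use upper lower in auto)
  show ?thesis
  proof (rule that)
    show "I \<subseteq> {1..}"
      by (auto simp: I_def)
    show "(\<lambda>N. \<Sum>k\<in>I \<inter> {1..N}. t k) \<longlonglongrightarrow> x"
      unfolding sum by (rule lim)
  qed
qed

section \<open>Convexity of the set of traces\<close>

theorem theorem1p1:
  fixes M :: "('h::complex_hilbert \<Rightarrow>\<^sub>L 'h) set"
    and \<tau> :: "('h \<Rightarrow>\<^sub>L 'h) \<Rightarrow> complex"
    and e :: "nat \<Rightarrow> 'h \<Rightarrow>\<^sub>L 'h"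
    and t :: "nat \<Rightarrow> real"
  assumes "von_neumann_algebra M"
    and "infinite_dimensional M"
    and "atomic M"
    and "tracial_state M \<tau>"
    and "faithful_functional M \<tau>"
    and "normal_functional M \<tau>"
    and "\<And>n. n \<ge> 1 \<Longrightarrow> minimal_projection M (e n)"
    and "\<And>m n. m \<ge> 1 \<Longrightarrow> n \<ge> 1 \<Longrightarrow> m \<noteq> n \<Longrightarrow> e m o\<^sub>L e n = 0"
    and "\<And>x. (\<lambda>N. \<Sum>n=1..N. blinfun_apply (e n) x) \<longlonglongrightarrow> x"
    and "\<And>n. n \<ge> 1 \<Longrightarrow> t n = Re (\<tau> (e n))"
    and "\<And>n. n \<ge> 1 \<Longrightarrow> t (Suc n) \<le> t n"
  shows "convex (\<tau> ` projections M) \<longleftrightarrow> (\<forall>n\<ge>1. t n \<le> 1 - (\<Sum>k=1..n. t k))"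
proof -
  note M = assms(1) and trace = assms(4) and normal = assms(6) and orth = assms(8) and t = assms(10)
  have st: "state M \<tau>" and one: "\<tau> id_blinfun = 1"
    using trace by (auto simp: tracial_state_def state_def)
  have e: "e n \<in> projections M" if "n \<ge> 1" for n
    using assms(7)[OF that] by (simp add: minimal_projection_def)
  have real: "\<tau> p = complex_of_real (Re (\<tau> p))" if "p \<in> projections M" for p
    using state_projections[OF M st] that by force
  have subsum: "\<exists>T\<in>projections M. \<tau> T = complex_of_real x"
    if I: "I \<subseteq> {1..}" and x: "(\<lambda>N. \<Sum>k\<in>I \<inter> {1..N}. t k) \<longlonglongrightarrow> x" for I x
  proof -
    obtain T where T: "T \<in> projections M"
      and lim: "(\<lambda>N. \<Sum>i\<in>I \<inter> {1..N}. Re (\<tau> (e i))) \<longlonglongrightarrow> Re (\<tau> T)"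
      by (rule orthogonal_projections_infinite_sum[OF M st normal, of I e]) (use I in \<open>auto intro!: e orth dest: subsetD\<close>)
    have "(\<lambda>N. \<Sum>k\<in>I \<inter> {1..N}. t k) = (\<lambda>N. \<Sum>i\<in>I \<inter> {1..N}. Re (\<tau> (e i)))"
      by (intro ext sum.cong) (auto simp: t)
    then have "Re (\<tau> T) = x"
      using lim x LIMSEQ_unique by metis
    then show ?thesis
      using T real by metis
  qed
  \<comment> \<open>The strong sum of all \<open>e n\<close> is the identity, whose trace is
    1.\<close>
  have total: "(\<lambda>N. \<Sum>k=1..N. t k) \<longlonglongrightarrow> 1"
  proof -
    obtain T where T: "\<And>x. (\<lambda>N. \<Sum>i\<in>{1..} \<inter> {1..N}. blinfun_apply (e i) x) \<longlonglongrightarrow> blinfun_apply T x"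
      and lim: "(\<lambda>N. \<Sum>i\<in>{1..} \<inter> {1..N}. Re (\<tau> (e i))) \<longlonglongrightarrow> Re (\<tau> T)"
      by (rule orthogonal_projections_infinite_sum[OF M st normal, of "{1..}" e]) (use e orth in auto)
    have Int: "{1..} \<inter> {1..N} = {1..N}" for N :: nat
      by auto
    have "T = id_blinfun"
      using LIMSEQ_unique[OF T[unfolded Int] assms(9)] by (intro blinfun_eqI) simp
    then show ?thesis
      using lim by (simp add: Int one t)
  qed
  show ?thesis
  proof
    assume tail: "\<forall>n\<ge>1. t n \<le> 1 - (\<Sum>k=1..n. t k)"
    have "complex_of_real x \<in> \<tau> ` projections M" if x: "x \<in> {0..1}" for x
    proof -
      obtain I where "I \<subseteq> {1..}" "(\<lambda>N. \<Sum>k\<in>I \<inter> {1..N}. t k) \<longlonglongrightarrow> x"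
        by (rule subsum_exists[OF total, of x]) (use tail x in auto)
      from subsum[OF this] show ?thesis by (metis image_eqI)
    qed
    \<comment> \<open>The set of traces is all of \<open>[0,1]\<close>, embedded in the complex
      plane by a linear map.\<close>
    then have "\<tau> ` projections M = complex_of_real ` {0..1}"
      using state_projections[OF M st] by auto
    then show "convex (\<tau> ` projections M)"
      by (simp add: convex_linear_image bounded_linear.linear[OF bounded_linear_of_real])
  next
    assume convex: "convex (\<tau> ` projections M)"
    show "\<forall>n\<ge>1. t n \<le> 1 - (\<Sum>k=1..n. t k)"
    proof (intro allI impI, rule ccontr)
      fix n :: nat
      assume n: "n \<ge> 1" and gap: "\<not> t n \<le> 1 - (\<Sum>k=1..n. t k)"
      define f where "f = (\<Sum>k=1..n. e k)"
      have f: "f \<in> projections M"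
        unfolding f_def by (rule orthogonal_projections_sum(2)[OF M]) (use e orth in auto)
      have \<tau>f: "Re (\<tau> f) = (\<Sum>k=1..n. t k)"
        unfolding f_def using state_sum[OF M st, of "{1..n}" e] projectionsD(1)[OF e] by (simp add: t)
      \<comment> \<open>Both ends of the gap lie in \<open>[0,1]\<close>, the second because
        \<open>f\<close> is a projection with trace \<open>\<Sum>k=1..n. t k\<close>. So any point
        of the gap is a convex combination of \<open>\<tau> 0 = 0\<close> and
        \<open>\<tau> id_blinfun = 1\<close>, and by convexity the trace of some projection
        \<open>p\<close>.\<close>
      have t_unit: "t n \<in> {0..1}" "1 - (\<Sum>k=1..n. t k) \<in> {0..1}"
        using state_projections[OF M st] e[OF n] f n unfolding \<tau>f[symmetric] by (force simp: t)+
      obtain x where x: "1 - (\<Sum>k=1..n. t k) < x" "x < t n"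
        using gap dense[of "1 - (\<Sum>k=1..n. t k)" "t n"] by auto
      have "id_blinfun \<in> projections M" "0 \<in> projections M"
        by (auto intro!: projectionsI[OF M] von_neumann_algebraD[OF M])
      moreover have "\<tau> 0 = 0"
        using state_sum[OF M st, of "{}"] by simp
      ultimately have "(1 - x) *\<^sub>R \<tau> 0 + x *\<^sub>R \<tau> id_blinfun \<in> \<tau> ` projections M"
        using convexD_alt[OF convex, of "\<tau> 0" "\<tau> id_blinfun" x] x t_unit by auto
      then obtain p where p: "p \<in> projections M" and \<tau>p: "\<tau> p = complex_of_real x"
        using \<open>\<tau> 0 = 0\<close> one by (auto simp: scaleR_conv_of_real)
      show False
      proof (cases "\<forall>k\<in>{1..n}. p o\<^sub>L e k = 0")
        case True
        then have "blinfun_apply p (blinfun_apply (e k) y) = 0" if "k \<in> {1..n}" for k y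
          using that by (simp flip: blinfun_apply_blinfun_compose)
        then have "p o\<^sub>L f = 0"
          by (intro blinfun_eqI) (simp add: f_def blinfun.sum_left blinfun.sum_right)
        from orthogonal_projections_trace[OF M st p f this] show False
          using x by (simp add: \<tau>f \<tau>p)
      next
        case False
        then obtain k where k: "1 \<le> k" "k \<le> n" "p o\<^sub>L e k \<noteq> 0"
          by auto
        \<comment> \<open>The monotonicity assumption speaks of indices from 1 on, so the induction
          from \<open>k\<close> up to \<open>n\<close> carries \<open>1 \<le> k\<close>
          along.\<close>
        have "t n \<le> t k"
          using k(2,1) by (induction rule: dec_induct) (auto intro: order_trans[OF assms(11)])
        moreover have "t k \<le> x"
          using minimal_projection_trace_le[OF M trace normal assms(7) p k(3)] k(1) by (simp add: t \<tau>p)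
        ultimately show False using x by simp
      qed
    qed
  qed
qed

end
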